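(* Let $F^\pm\in\mathcal E(\lambda,\Lambda)$, $f^\pm\in C(B_1^\pm\cup T)$, $g\in C(T)$. A function $u\in\operatorname{USC}(B_1)$ is a viscosity subsolution of the flat problem (FP) if and only if condition (i) of the definition holds and, in place of (ii), the following holds: whenever $x_0\in T$ and $\varphi\in C(B_\delta(x_0))$ with $\varphi^\pm:=\varphi|_{\overline{B^\pm_\delta(x_0)}}\in C^2(\overline{B^\pm_\delta(x_0)})$ touches $u$ from above at $x_0$, then $$F^+(D^2\varphi^+(x_0))\ge f^+(x_0)\quad\text{or}\quad F^-(D^2\varphi^-(x_0))\ge f^-(x_0)\quad\text{or}\quad\varphi^+_{x_n}(x_0)-\varphi^-_{x_n}(x_0)\ge g(x_0).$$ The analogous statement holds for supersolutions (with touching from below and reversed inequalities).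
   Context: $\mathcal E(\lambda,\Lambda)$: the class of $F:\mathcal S^n\to\mathbb R$ with $F(0)=0$ and $\lambda\|N\|\le F(M+N)-F(M)\le\Lambda\|N\|$ for all symmetric $M$ and $N\ge0$. Flat setting: $B_r^\pm=B_r\cap\{\pm x_n>0\}$, $B_\delta^\pm(x_0)=B_\delta(x_0)\cap\{\pm x_n>0\}$, $T=B_1\cap\{x_n=0\}$. The flat problem (FP) is $F^\pm(D^2u)=f^\pm$ in $B_1^\pm$, $u^+_{x_n}-u^-_{x_n}=g$ on $T$. Definition: $u\in\operatorname{USC}(B_1)$ is a viscosity subsolution of (FP) if for any $\varphi$ touching $u$ from above at $x_0\in B_1$: (i) if $x_0\in B_1^\pm$ and $\varphi\in C^2(B_\delta(x_0))$, then $F^\pm(D^2\varphi(x_0))\ge f^\pm(x_0)$; (ii) if $x_0\in T$ and $\varphi$ is continuous with $\varphi^\pm=\varphi|_{\overline{B^\pm_\delta(x_0)}}\in C^2(\overline{B^\pm_\delta(x_0)})$, then $\varphi^+_{x_n}(x_0)-\varphi^-_{x_n}(x_0)\ge g(x_0)$. Supersolutions: lower semicontinuous, touching from below, reversed inequalities; solutions are both. *)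

theory Defs
  imports "HOL-Analysis.Analysis"
begin

text \<open>Points of R^n are vectors real^'n; the distinguished normal coordinate x_n is
  the coordinate with index k :: 'n.  Matrices are real^'n^'n.\<close>

definition usc_on :: "('a::metric_space \<Rightarrow> real) \<Rightarrow> 'a set \<Rightarrow> bool" where
  "usc_on u S \<longleftrightarrow> (\<forall>x\<in>S. \<forall>e>0. \<exists>d>0. \<forall>y\<in>S. dist y x < d \<longrightarrow> u y < u x + e)"

definition lsc_on :: "('a::metric_space \<Rightarrow> real) \<Rightarrow> 'a set \<Rightarrow> bool" where
  "lsc_on u S \<longleftrightarrow> (\<forall>x\<in>S. \<forall>e>0. \<exists>d>0. \<forall>y\<in>S. dist y x < d \<longrightarrow> u x - e < u y)"

definition sym_mat :: "real^'n^'n \<Rightarrow> bool" where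
  "sym_mat M \<longleftrightarrow> transpose M = M"

text \<open>N \<ge> 0 in S^n: symmetric positive semidefinite.\<close>
definition psd_mat :: "real^'n^'n \<Rightarrow> bool" where
  "psd_mat N \<longleftrightarrow> sym_mat N \<and> (\<forall>x. 0 \<le> x \<bullet> (N *v x))"

text \<open>The class E(lambda, Lambda); \<open>\<parallel>N\<parallel>\<close> is the operator norm.\<close>
definition ellipticE :: "real \<Rightarrow> real \<Rightarrow> (real^'n^'n \<Rightarrow> real) \<Rightarrow> bool" where
  "ellipticE l L F \<longleftrightarrow> F 0 = 0 \<and>
     (\<forall>M N. sym_mat M \<and> psd_mat N \<longrightarrow>
        l * onorm (\<lambda>x. N *v x) \<le> F (M + N) - F M \<and>
        F (M + N) - F M \<le> L * onorm (\<lambda>x. N *v x))"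

text \<open>C^2 on a set S (possibly closed, e.g. a closed half ball): D is the gradient
  and H the Hessian, both continuous on S, derivatives taken within S
  (one-sided at boundary points).\<close>
definition C2_on :: "(real^'n) set \<Rightarrow> (real^'n \<Rightarrow> real) \<Rightarrow> (real^'n \<Rightarrow> real^'n)
    \<Rightarrow> (real^'n \<Rightarrow> real^'n^'n) \<Rightarrow> bool" where
  "C2_on S \<phi> D H \<longleftrightarrow> continuous_on S D \<and> continuous_on S H \<and>
     (\<forall>x\<in>S. (\<phi> has_derivative (\<lambda>h. D x \<bullet> h)) (at x within S) \<and>
            (D has_derivative (\<lambda>h. H x *v h)) (at x within S))"

definition B1 :: "(real^'n) set" where "B1 = ball 0 1"
definition B1p :: "'n \<Rightarrow> (real^'n) set" where "B1p k = ball 0 1 \<inter> {x. x $ k > 0}"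
definition B1m :: "'n \<Rightarrow> (real^'n) set" where "B1m k = ball 0 1 \<inter> {x. x $ k < 0}"
definition Tflat :: "'n \<Rightarrow> (real^'n) set" where "Tflat k = ball 0 1 \<inter> {x. x $ k = 0}"

text \<open>closures of B_delta^+(x0), B_delta^-(x0)\<close>
definition cBp :: "'n \<Rightarrow> real^'n \<Rightarrow> real \<Rightarrow> (real^'n) set" where
  "cBp k x0 d = cball x0 d \<inter> {x. x $ k \<ge> 0}"
definition cBm :: "'n \<Rightarrow> real^'n \<Rightarrow> real \<Rightarrow> (real^'n) set" where
  "cBm k x0 d = cball x0 d \<inter> {x. x $ k \<le> 0}"

text \<open>phi touches u from above (below) at x0 within B_delta(x0) (intersected with B_1).\<close>
definition touch_above :: "(real^'n \<Rightarrow> real) \<Rightarrow> (real^'n \<Rightarrow> real) \<Rightarrow> real^'n \<Rightarrow> real \<Rightarrow> bool" where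
  "touch_above u \<phi> x0 d \<longleftrightarrow> \<phi> x0 = u x0 \<and> (\<forall>x\<in>ball x0 d \<inter> B1. u x \<le> \<phi> x)"
definition touch_below :: "(real^'n \<Rightarrow> real) \<Rightarrow> (real^'n \<Rightarrow> real) \<Rightarrow> real^'n \<Rightarrow> real \<Rightarrow> bool" where
  "touch_below u \<phi> x0 d \<longleftrightarrow> \<phi> x0 = u x0 \<and> (\<forall>x\<in>ball x0 d \<inter> B1. \<phi> x \<le> u x)"

text \<open>Condition (i) for sub/supersolutions.\<close>
definition cond_i_sub where
  "cond_i_sub k Fp Fm fp fm u \<longleftrightarrow>
    (\<forall>x0 d \<phi> D H. x0 \<in> B1 \<and> 0 < d \<and> C2_on (ball x0 d) \<phi> D H \<and> touch_above u \<phi> x0 d \<longrightarrow>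
       (x0 \<in> B1p k \<longrightarrow> Fp (H x0) \<ge> fp x0) \<and> (x0 \<in> B1m k \<longrightarrow> Fm (H x0) \<ge> fm x0))"
definition cond_i_super where
  "cond_i_super k Fp Fm fp fm u \<longleftrightarrow>
    (\<forall>x0 d \<phi> D H. x0 \<in> B1 \<and> 0 < d \<and> C2_on (ball x0 d) \<phi> D H \<and> touch_below u \<phi> x0 d \<longrightarrow>
       (x0 \<in> B1p k \<longrightarrow> Fp (H x0) \<le> fp x0) \<and> (x0 \<in> B1m k \<longrightarrow> Fm (H x0) \<le> fm x0))"

text \<open>Condition (ii) (transmission condition on T).\<close>
definition cond_ii_sub where
  "cond_ii_sub k g u \<longleftrightarrow>
    (\<forall>x0 d \<phi> Dp Hp Dm Hm. x0 \<in> Tflat k \<and> 0 < d \<and> continuous_on (ball x0 d) \<phi> \<and>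
       C2_on (cBp k x0 d) \<phi> Dp Hp \<and> C2_on (cBm k x0 d) \<phi> Dm Hm \<and> touch_above u \<phi> x0 d \<longrightarrow>
       Dp x0 $ k - Dm x0 $ k \<ge> g x0)"
definition cond_ii_super where
  "cond_ii_super k g u \<longleftrightarrow>
    (\<forall>x0 d \<phi> Dp Hp Dm Hm. x0 \<in> Tflat k \<and> 0 < d \<and> continuous_on (ball x0 d) \<phi> \<and>
       C2_on (cBp k x0 d) \<phi> Dp Hp \<and> C2_on (cBm k x0 d) \<phi> Dm Hm \<and> touch_below u \<phi> x0 d \<longrightarrow>
       Dp x0 $ k - Dm x0 $ k \<le> g x0)"

text \<open>The alternative (relaxed) condition on T.\<close>
definition cond_ii'_sub where
  "cond_ii'_sub k Fp Fm fp fm g u \<longleftrightarrow>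
    (\<forall>x0 d \<phi> Dp Hp Dm Hm. x0 \<in> Tflat k \<and> 0 < d \<and> continuous_on (ball x0 d) \<phi> \<and>
       C2_on (cBp k x0 d) \<phi> Dp Hp \<and> C2_on (cBm k x0 d) \<phi> Dm Hm \<and> touch_above u \<phi> x0 d \<longrightarrow>
       Fp (Hp x0) \<ge> fp x0 \<or> Fm (Hm x0) \<ge> fm x0 \<or> Dp x0 $ k - Dm x0 $ k \<ge> g x0)"
definition cond_ii'_super where
  "cond_ii'_super k Fp Fm fp fm g u \<longleftrightarrow>
    (\<forall>x0 d \<phi> Dp Hp Dm Hm. x0 \<in> Tflat k \<and> 0 < d \<and> continuous_on (ball x0 d) \<phi> \<and>
       C2_on (cBp k x0 d) \<phi> Dp Hp \<and> C2_on (cBm k x0 d) \<phi> Dm Hm \<and> touch_below u \<phi> x0 d \<longrightarrow>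
       Fp (Hp x0) \<le> fp x0 \<or> Fm (Hm x0) \<le> fm x0 \<or> Dp x0 $ k - Dm x0 $ k \<le> g x0)"

definition visc_sub_FP where
  "visc_sub_FP k Fp Fm fp fm g u \<longleftrightarrow>
     usc_on u B1 \<and> cond_i_sub k Fp Fm fp fm u \<and> cond_ii_sub k g u"
definition visc_super_FP where
  "visc_super_FP k Fp Fm fp fm g u \<longleftrightarrow>
     lsc_on u B1 \<and> cond_i_super k Fp Fm fp fm u \<and> cond_ii_super k g u"

end

theory Submission
  imports Defs
begin

text \<open>
  Condition (ii) trivially implies the relaxed one. Conversely, let \<open>\<phi>\<close> touch \<open>u\<close> from above
  at \<open>x0 \<in> T\<close> with a jump of normal derivatives below \<open>g x0\<close>. The two one-sided first order
  expansions of \<open>\<phi>\<close> agree in tangential directions, so near \<open>x0\<close> the function \<open>\<phi>\<close> lies below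
  a piecewise quadratic \<open>\<psi>\<close> with Hessian \<open>2K I - 2M e_n e_n^T\<close> on both sides, \<open>\<psi> x0 = \<phi> x0\<close>,
  and the jump raised by \<open>2\<delta>\<close>, still below \<open>g x0\<close>: the concave term \<open>-M x_n^2\<close> is absorbed by
  the kink on the slab \<open>M |x_n| \<le> \<delta>\<close>. So \<open>\<psi>\<close> touches \<open>u\<close> from above, while ellipticity gives
  \<open>F(2K I - 2M e_n e_n^T) \<le> F(2K I) - 2\<lambda>M\<close>, which lies below \<open>f(x0)\<close> on both sides once \<open>M\<close> is
  large; all three alternatives of the relaxed condition fail for \<open>\<psi>\<close>.
  Supersolutions reduce to subsolutions through \<open>u \<mapsto> -u\<close>, \<open>F \<mapsto> -F(-X)\<close>, which preserves the
  class \<open>E(\<lambda>, \<Lambda>)\<close>.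
\<close>

lemma C2_on_first_order_estimate:
  fixes \<phi> :: "real^'n \<Rightarrow> real"
  assumes C2: "C2_on S \<phi> D H" and "convex S" and x0: "x0 \<in> S"
  shows "\<exists>C r. 0 < r \<and> 0 \<le> C \<and> (\<forall>x\<in>S. norm (x - x0) < r \<longrightarrow>
            \<bar>\<phi> x - \<phi> x0 - D x0 \<bullet> (x - x0)\<bar> \<le> C * (norm (x - x0))\<^sup>2)"
proof -
  have d\<phi>: "\<And>x. x \<in> S \<Longrightarrow> (\<phi> has_derivative (\<lambda>h. D x \<bullet> h)) (at x within S)"
    and dD: "(D has_derivative (\<lambda>h. H x0 *v h)) (at x0 within S)"
    using C2 x0 unfolding C2_on_def by auto
  obtain r where r: "r > 0" "\<forall>y\<in>S. norm (y - x0) < r \<longrightarrow>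
      norm (D y - D x0 - H x0 *v (y - x0)) \<le> 1 * norm (y - x0)"
    using dD unfolding has_derivative_within_alt by (meson zero_less_one)
  define B where "B = onorm (\<lambda>h. H x0 *v h)"
  have B0: "0 \<le> B" unfolding B_def by (simp add: onorm_pos_le)
  have D_lipschitz: "norm (D y - D x0) \<le> (B + 1) * norm (y - x0)"
    if "y \<in> S" "norm (y - x0) < r" for y
  proof -
    have "norm (D y - D x0) \<le> norm (D y - D x0 - H x0 *v (y - x0)) + norm (H x0 *v (y - x0))"
      by (metis diff_add_cancel norm_triangle_ineq)
    also have "\<dots> \<le> norm (y - x0) + B * norm (y - x0)"
      using r that onorm[OF matrix_vector_mul_bounded_linear, of "H x0" "y - x0"] unfolding B_def
      by (intro add_mono) auto
    finally show ?thesis by (simp add: algebra_simps)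
  qed
  have "\<bar>\<phi> x - \<phi> x0 - D x0 \<bullet> (x - x0)\<bar> \<le> (B + 1) * (norm (x - x0))\<^sup>2"
    if x: "x \<in> S" "norm (x - x0) < r" for x
  proof -
    define \<rho> where "\<rho> = norm (x - x0)"
    define S' where "S' = S \<inter> cball x0 \<rho>"
    have "convex S'" unfolding S'_def using \<open>convex S\<close> by (simp add: convex_Int)
    moreover have x0S': "x0 \<in> S'" and "x \<in> S'" using x0 x unfolding S'_def \<rho>_def
      by (auto simp: dist_norm norm_minus_commute)
    ultimately have segment: "x0 + t *\<^sub>R (x - x0) \<in> S'" if "t \<in> {0..1}" for t
      using that convexD_alt[of S' x0 x t] by (simp add: algebra_simps)
    have "(\<phi> has_derivative (\<lambda>h. D y \<bullet> h)) (at y within S')" if "y \<in> S'" for y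
      using d\<phi>[of y] that unfolding S'_def by (auto intro: has_derivative_subset)
    moreover have "onorm ((\<lambda>h. D y \<bullet> h) - (\<lambda>h. D x0 \<bullet> h)) \<le> (B + 1) * \<rho>" if "y \<in> S'" for y
    proof -
      have "onorm ((\<lambda>h. D y \<bullet> h) - (\<lambda>h. D x0 \<bullet> h)) \<le> norm (D y - D x0)"
        by (rule onorm_bound) (auto simp: Cauchy_Schwarz_ineq2 inner_diff_left[symmetric])
      also have "\<dots> \<le> (B + 1) * norm (y - x0)"
        using that x unfolding S'_def \<rho>_def
        by (intro D_lipschitz) (auto simp: dist_norm norm_minus_commute)
      also have "\<dots> \<le> (B + 1) * \<rho>"
        using that B0 unfolding S'_def by (intro mult_left_mono) (auto simp: dist_norm norm_minus_commute)
      finally show ?thesis .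
    qed
    ultimately have "norm (\<phi> x - \<phi> x0 - D x0 \<bullet> (x - x0)) \<le> norm (x - x0) * ((B + 1) * \<rho>)"
      using differentiable_bound_linearization[where f'="\<lambda>y h. D y \<bullet> h", OF segment _ _ x0S']
      by blast
    then show ?thesis
      unfolding \<rho>_def by (simp add: power2_eq_square algebra_simps)
  qed
  then show ?thesis using B0 r(1) by (intro exI[of _ "B+1"] exI[of _ r]) auto
qed

lemma convex_cBp:
  fixes k :: "'n::finite"
  shows "convex (cBp k x0 d)"
proof -
  have "{x::real^'n. x $ k \<ge> 0} = {x. axis k 1 \<bullet> x \<ge> 0}" by (simp add: inner_axis')
  then show ?thesis unfolding cBp_def using convex_halfspace_ge[of 0 "axis k (1::real)"]
    by (metis convex_Int convex_cball)
qed

lemma convex_cBm: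
  fixes k :: "'n::finite"
  shows "convex (cBm k x0 d)"
proof -
  have "{x::real^'n. x $ k \<le> 0} = {x. axis k 1 \<bullet> x \<le> 0}" by (simp add: inner_axis')
  then show ?thesis unfolding cBm_def using convex_halfspace_le[of "axis k (1::real)" 0]
    by (metis convex_Int convex_cball)
qed

lemma centre_in_cBp_cBm:
  assumes "x0 $ k = 0" "0 \<le> d"
  shows "x0 \<in> cBp k x0 d" "x0 \<in> cBm k x0 d"
  using assms unfolding cBp_def cBm_def by auto

lemma C2_on_half_balls_first_order_estimate:
  fixes \<phi> :: "real^'n::finite \<Rightarrow> real"
  assumes Cp: "C2_on (cBp k x0 d) \<phi> Dp Hp" and Cm: "C2_on (cBm k x0 d) \<phi> Dm Hm"
    and x0k: "x0 $ k = 0" and "0 < d"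
  obtains r C where "0 < r" "r \<le> d" "0 \<le> C"
    "\<And>x. x \<in> cBp k x0 d \<Longrightarrow> norm (x - x0) < r \<Longrightarrow>
      \<bar>\<phi> x - \<phi> x0 - Dp x0 \<bullet> (x - x0)\<bar> \<le> C * (norm (x - x0))\<^sup>2"
    "\<And>x. x \<in> cBm k x0 d \<Longrightarrow> norm (x - x0) < r \<Longrightarrow>
      \<bar>\<phi> x - \<phi> x0 - Dm x0 \<bullet> (x - x0)\<bar> \<le> C * (norm (x - x0))\<^sup>2"
proof -
  have x0: "x0 \<in> cBp k x0 d" "x0 \<in> cBm k x0 d"
    using centre_in_cBp_cBm[OF x0k] \<open>0 < d\<close> by simp_all
  obtain Cp' rp where p: "0 < rp" "0 \<le> Cp'" "\<forall>x\<in>cBp k x0 d. norm (x - x0) < rp \<longrightarrow>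
      \<bar>\<phi> x - \<phi> x0 - Dp x0 \<bullet> (x - x0)\<bar> \<le> Cp' * (norm (x - x0))\<^sup>2"
    using C2_on_first_order_estimate[OF Cp convex_cBp x0(1)] by blast
  obtain Cm' rm where m: "0 < rm" "0 \<le> Cm'" "\<forall>x\<in>cBm k x0 d. norm (x - x0) < rm \<longrightarrow>
      \<bar>\<phi> x - \<phi> x0 - Dm x0 \<bullet> (x - x0)\<bar> \<le> Cm' * (norm (x - x0))\<^sup>2"
    using C2_on_first_order_estimate[OF Cm convex_cBm x0(2)] by blast
  have "Cp' * (norm (x - x0))\<^sup>2 \<le> max Cp' Cm' * (norm (x - x0))\<^sup>2"
    and "Cm' * (norm (x - x0))\<^sup>2 \<le> max Cp' Cm' * (norm (x - x0))\<^sup>2" for x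
    by (simp_all add: mult_right_mono)
  with p m \<open>0 < d\<close> show ?thesis
    by (intro that[of "min rp (min rm d)" "max Cp' Cm'"]) (force intro: order_trans)+
qed

lemma nonpos_if_linear_le_quadratic:
  fixes c C r :: real
  assumes "0 < r" and le: "\<And>t. 0 < t \<Longrightarrow> t < r \<Longrightarrow> t * c \<le> C * t\<^sup>2"
  shows "c \<le> 0"
proof (rule ccontr)
  assume "\<not> c \<le> 0"
  define t where "t = min (r / 2) (c / (2 * (\<bar>C\<bar> + 1)))"
  have t: "0 < t" "t < r" using \<open>0 < r\<close> \<open>\<not> c \<le> 0\<close> unfolding t_def by auto
  have "C * t \<le> (\<bar>C\<bar> + 1) * t" using t by (intro mult_right_mono) auto
  also have "\<dots> \<le> c / 2"
    unfolding t_def by (simp add: min_def field_simps add_pos_nonneg)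
  finally have "C * t\<^sup>2 \<le> t * c / 2"
    using t mult_right_mono[of "C * t" "c / 2" t] by (simp add: power2_eq_square mult.commute)
  then have "t * c \<le> 0" using le[OF t] by linarith
  then show False using t \<open>\<not> c \<le> 0\<close> by (simp add: mult_le_0_iff)
qed

lemma one_sided_gradients_agree_tangentially:
  fixes \<phi> :: "real^'n::finite \<Rightarrow> real"
  assumes "C2_on (cBp k x0 d) \<phi> Dp Hp" and "C2_on (cBm k x0 d) \<phi> Dm Hm"
    and x0k: "x0 $ k = 0" and "0 < d" and vk: "v $ k = 0"
  shows "Dp x0 \<bullet> v = Dm x0 \<bullet> v"
proof -
  obtain r C where "0 < r" "r \<le> d" "0 \<le> C"
    and ep: "\<And>x. x \<in> cBp k x0 d \<Longrightarrow> norm (x - x0) < r \<Longrightarrow>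
      \<bar>\<phi> x - \<phi> x0 - Dp x0 \<bullet> (x - x0)\<bar> \<le> C * (norm (x - x0))\<^sup>2"
    and em: "\<And>x. x \<in> cBm k x0 d \<Longrightarrow> norm (x - x0) < r \<Longrightarrow>
      \<bar>\<phi> x - \<phi> x0 - Dm x0 \<bullet> (x - x0)\<bar> \<le> C * (norm (x - x0))\<^sup>2"
    by (rule C2_on_half_balls_first_order_estimate[OF assms(1-4)]) (rule that)
  have "t * \<bar>Dp x0 \<bullet> v - Dm x0 \<bullet> v\<bar> \<le> (2 * C * (norm v)\<^sup>2) * t\<^sup>2"
    if t: "0 < t" "t < r / (norm v + 1)" for t
  proof -
    define x where "x = x0 + t *\<^sub>R v"
    have xx: "x - x0 = t *\<^sub>R v" and nx: "norm (x - x0) = t * norm v"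
      using t unfolding x_def by simp_all
    have "t * norm v \<le> t * (norm v + 1)" using t by simp
    also have "\<dots> < r"
      using t pos_less_divide_eq[of "norm v + 1" t r] by (simp add: add_nonneg_pos)
    finally have "norm (x - x0) < r" unfolding nx .
    moreover have "x $ k = 0" using x0k vk unfolding x_def by simp
    ultimately have "x \<in> cBp k x0 d" "x \<in> cBm k x0 d"
      using \<open>r \<le> d\<close> unfolding cBp_def cBm_def by (auto simp: dist_norm norm_minus_commute)
    with \<open>norm (x - x0) < r\<close>
    have "\<bar>\<phi> x - \<phi> x0 - Dp x0 \<bullet> (x - x0)\<bar> \<le> C * (norm (x - x0))\<^sup>2"
      and "\<bar>\<phi> x - \<phi> x0 - Dm x0 \<bullet> (x - x0)\<bar> \<le> C * (norm (x - x0))\<^sup>2"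
      by (simp_all add: ep em)
    then have "\<bar>\<phi> x - \<phi> x0 - t * (Dp x0 \<bullet> v)\<bar> \<le> C * (t * norm v)\<^sup>2"
      and "\<bar>\<phi> x - \<phi> x0 - t * (Dm x0 \<bullet> v)\<bar> \<le> C * (t * norm v)\<^sup>2"
      unfolding nx unfolding xx by (simp_all add: inner_scaleR_right)
    then have "\<bar>t * (Dp x0 \<bullet> v) - t * (Dm x0 \<bullet> v)\<bar> \<le> 2 * (C * (t * norm v)\<^sup>2)"
      by linarith
    then show ?thesis
      using t by (simp add: abs_mult right_diff_distrib[symmetric] power_mult_distrib mult_ac)
  qed
  then have "\<bar>Dp x0 \<bullet> v - Dm x0 \<bullet> v\<bar> \<le> 0"
    using \<open>0 < r\<close> by (intro nonpos_if_linear_le_quadratic[of "r / (norm v + 1)"])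
      (auto simp: add_nonneg_pos)
  then show ?thesis by simp
qed

lemma one_sided_gradients_differ_normally:
  fixes \<phi> :: "real^'n \<Rightarrow> real"
  assumes "C2_on (cBp k x0 d) \<phi> Dp Hp" "C2_on (cBm k x0 d) \<phi> Dm Hm" "x0 $ k = 0" "0 < d"
  shows "Dm x0 \<bullet> h = Dp x0 \<bullet> h + (Dm x0 $ k - Dp x0 $ k) * h $ k"
proof -
  define v where "v = h - (h $ k) *\<^sub>R axis k 1"
  have "Dp x0 \<bullet> v = Dm x0 \<bullet> v"
    using one_sided_gradients_agree_tangentially[OF assms] by (simp add: v_def)
  moreover have "y \<bullet> h = y \<bullet> v + h $ k * y $ k" for y :: "real^'n"
    unfolding v_def by (simp add: inner_diff_right inner_axis)
  ultimately show ?thesis by (simp add: algebra_simps)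
qed

lemma C2_on_cong:
  assumes "C2_on S P D H" and "\<And>x. x \<in> S \<Longrightarrow> f x = P x"
  shows "C2_on S f D H"
  using assms unfolding C2_on_def
  by (metis has_derivative_transform_within zero_less_one)

lemma C2_on_uminus:
  assumes "C2_on S \<phi> D H"
  shows "C2_on S (\<lambda>x. - \<phi> x) (\<lambda>x. - D x) (\<lambda>x. - H x)"
proof -
  have uminus_mult: "(- A) *v h = - (A *v h)" for A :: "real^'n^'n" and h
    by (simp add: vec_eq_iff matrix_vector_mult_def sum_negf)
  show ?thesis using assms unfolding C2_on_def
    by (auto intro!: continuous_on_minus has_derivative_eq_rhs[OF has_derivative_minus]
        simp: fun_eq_iff uminus_mult)
qed

definition coord_proj :: "'n::finite \<Rightarrow> real^'n^'n" where
  "coord_proj k = (\<chi> i j. if i = k \<and> j = k then 1 else 0)"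

lemma coord_proj_mult: "coord_proj k *v h = (h $ k) *\<^sub>R axis k 1"
  by (simp add: vec_eq_iff matrix_vector_mult_def coord_proj_def axis_def
      if_distrib[of "\<lambda>x. x * _"] cong: if_cong)

lemma sym_mat_diff: "sym_mat A \<Longrightarrow> sym_mat B \<Longrightarrow> sym_mat (A - B)"
  by (simp add: sym_mat_def vec_eq_iff transpose_def)

lemma sym_mat_scaled_identity: "sym_mat (c *\<^sub>R mat 1)"
  by (simp add: sym_mat_def vec_eq_iff transpose_def mat_def)

lemma psd_mat_scaled_coord_proj:
  assumes "0 \<le> t"
  shows "psd_mat (t *\<^sub>R coord_proj k)"
proof -
  have "x \<bullet> ((t *\<^sub>R coord_proj k) *v x) = t * (x $ k)\<^sup>2" for x
    by (simp add: scaleR_matrix_vector_assoc[symmetric] coord_proj_mult inner_axis power2_eq_square)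
  moreover have "transpose (t *\<^sub>R coord_proj k) = t *\<^sub>R coord_proj k"
    by (auto simp: vec_eq_iff transpose_def coord_proj_def)
  ultimately show ?thesis unfolding psd_mat_def sym_mat_def using assms by simp
qed

lemma onorm_scaled_coord_proj_ge:
  assumes "0 \<le> t"
  shows "t \<le> onorm (\<lambda>x. (t *\<^sub>R coord_proj k) *v x)"
proof -
  have "norm ((t *\<^sub>R coord_proj k) *v axis k 1)
      \<le> onorm (\<lambda>x. (t *\<^sub>R coord_proj k) *v x) * norm (axis k (1::real))"
    by (rule onorm[OF matrix_vector_mul_bounded_linear])
  then show ?thesis
    using assms by (simp add: scaleR_matrix_vector_assoc[symmetric] coord_proj_mult)
qed

lemma ellipticE_minus_coord_proj:
  assumes "ellipticE l L F" and "sym_mat H" and "0 \<le> t" and "0 \<le> l"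
  shows "F (H - t *\<^sub>R coord_proj k) \<le> F H - l * t"
proof -
  have "sym_mat (t *\<^sub>R coord_proj k)"
    using psd_mat_scaled_coord_proj[OF \<open>0 \<le> t\<close>] unfolding psd_mat_def by blast
  then have "l * onorm (\<lambda>x. (t *\<^sub>R coord_proj k) *v x)
      \<le> F (H - t *\<^sub>R coord_proj k + t *\<^sub>R coord_proj k) - F (H - t *\<^sub>R coord_proj k)"
    using assms(1) sym_mat_diff[OF \<open>sym_mat H\<close>] psd_mat_scaled_coord_proj[OF \<open>0 \<le> t\<close>]
    unfolding ellipticE_def by blast
  moreover have "l * t \<le> l * onorm (\<lambda>x. (t *\<^sub>R coord_proj k) *v x)"
    using assms by (intro mult_left_mono onorm_scaled_coord_proj_ge) auto
  ultimately show ?thesis by simp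
qed

definition barrier_hessian :: "real \<Rightarrow> real \<Rightarrow> 'n::finite \<Rightarrow> real^'n^'n" where
  "barrier_hessian K M k = (2 * K) *\<^sub>R mat 1 - (2 * M) *\<^sub>R coord_proj k"

lemma barrier_hessian_mult:
  "barrier_hessian K M k *v h = (2 * K) *\<^sub>R h - (2 * M * h $ k) *\<^sub>R axis k 1"
  by (simp add: barrier_hessian_def matrix_vector_mult_diff_rdistrib coord_proj_mult
      scaleR_matrix_vector_assoc[symmetric])

lemma ellipticE_barrier_hessian:
  assumes "ellipticE l L F" and "0 \<le> M" and "0 \<le> l"
  shows "F (barrier_hessian K M k) \<le> F (barrier_hessian K 0 k) - 2 * l * M"
proof -
  have "F ((2 * K) *\<^sub>R mat 1 - (2 * M) *\<^sub>R coord_proj k) \<le> F ((2 * K) *\<^sub>R mat 1) - l * (2 * M)"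
    by (rule ellipticE_minus_coord_proj[OF assms(1) sym_mat_scaled_identity])
      (use assms in simp_all)
  moreover have "barrier_hessian K 0 k = (2 * K) *\<^sub>R mat 1"
    by (simp add: barrier_hessian_def)
  ultimately show ?thesis unfolding barrier_hessian_def by simp
qed

lemma C2_on_quadratic:
  fixes a x0 :: "real^'n::finite"
  shows "C2_on S (\<lambda>x. c + a \<bullet> (x - x0) + K * ((x - x0) \<bullet> (x - x0)) - M * (x $ k)\<^sup>2 + s * x $ k)
    (\<lambda>x. a + (2 * K) *\<^sub>R (x - x0) - (2 * M * x $ k) *\<^sub>R axis k 1 + s *\<^sub>R axis k 1)
    (\<lambda>_. barrier_hessian K M k)"
proof -
  have nth: "((\<lambda>x::real^'n. x $ k) has_derivative (\<lambda>h. h $ k)) F" for F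
    by (rule bounded_linear_imp_has_derivative[OF bounded_linear_vec_nth])
  have "((\<lambda>x. c + a \<bullet> (x - x0) + K * ((x - x0) \<bullet> (x - x0)) - M * (x $ k)\<^sup>2 + s * x $ k)
      has_derivative (\<lambda>h. (a + (2 * K) *\<^sub>R (x - x0) - (2 * M * x $ k) *\<^sub>R axis k 1
        + s *\<^sub>R axis k 1) \<bullet> h)) (at x within S)" for x
    by (rule has_derivative_eq_rhs, (auto intro!: derivative_eq_intros nth)[1])
      (simp add: fun_eq_iff inner_add_left inner_diff_left inner_axis' inner_axis algebra_simps
        power2_eq_square inner_commute)
  moreover have "((\<lambda>x. a + (2 * K) *\<^sub>R (x - x0) - (2 * M * x $ k) *\<^sub>R axis k 1 + s *\<^sub>R axis k 1)
      has_derivative (\<lambda>h. barrier_hessian K M k *v h)) (at x within S)" for x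
    by (rule has_derivative_eq_rhs, (auto intro!: derivative_eq_intros nth)[1])
      (simp add: fun_eq_iff barrier_hessian_mult algebra_simps)
  moreover have "continuous_on S
      (\<lambda>x. a + (2 * K) *\<^sub>R (x - x0) - (2 * M * x $ k) *\<^sub>R axis k 1 + s *\<^sub>R axis k 1)"
    by (intro continuous_intros)
  ultimately show ?thesis unfolding C2_on_def by simp
qed

definition kinked_quadratic ::
    "'n::finite \<Rightarrow> real^'n \<Rightarrow> real \<Rightarrow> real^'n \<Rightarrow> real \<Rightarrow> real \<Rightarrow> real \<Rightarrow> real \<Rightarrow> real^'n \<Rightarrow> real"
  where "kinked_quadratic k x0 c a K M sp sm x =
    c + a \<bullet> (x - x0) + K * ((x - x0) \<bullet> (x - x0)) - M * (x $ k)\<^sup>2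
      + sp * max (x $ k) 0 + sm * min (x $ k) 0"

lemma continuous_on_kinked_quadratic: "continuous_on S (kinked_quadratic k x0 c a K M sp sm)"
  unfolding kinked_quadratic_def by (intro continuous_intros)

lemma C2_on_cBp_kinked_quadratic:
  "C2_on (cBp k x0 r) (kinked_quadratic k x0 c a K M sp sm)
    (\<lambda>x. a + (2 * K) *\<^sub>R (x - x0) - (2 * M * x $ k) *\<^sub>R axis k 1 + sp *\<^sub>R axis k 1)
    (\<lambda>_. barrier_hessian K M k)"
  by (rule C2_on_cong[OF C2_on_quadratic]) (simp add: kinked_quadratic_def cBp_def)

lemma C2_on_cBm_kinked_quadratic:
  "C2_on (cBm k x0 r) (kinked_quadratic k x0 c a K M sp sm)
    (\<lambda>x. a + (2 * K) *\<^sub>R (x - x0) - (2 * M * x $ k) *\<^sub>R axis k 1 + sm *\<^sub>R axis k 1)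
    (\<lambda>_. barrier_hessian K M k)"
  by (rule C2_on_cong[OF C2_on_quadratic]) (simp add: kinked_quadratic_def cBm_def)

lemma kinked_quadratic_majorant:
  fixes \<phi> :: "real^'n::finite \<Rightarrow> real"
  assumes "C2_on (cBp k x0 d) \<phi> Dp Hp" and "C2_on (cBm k x0 d) \<phi> Dm Hm"
    and x0k: "x0 $ k = 0" and "0 < d"
  shows "\<exists>K r. 0 < r \<and> r \<le> d \<and> (\<forall>\<delta>>0. \<forall>M>0. \<forall>x\<in>ball x0 (min r (\<delta> / M)).
    \<phi> x \<le> kinked_quadratic k x0 (\<phi> x0) (Dp x0) K M \<delta> (Dm x0 $ k - Dp x0 $ k - \<delta>) x)"
proof -
  obtain r C where "0 < r" "r \<le> d" "0 \<le> C"
    and ep: "\<And>x. x \<in> cBp k x0 d \<Longrightarrow> norm (x - x0) < r \<Longrightarrow>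
      \<bar>\<phi> x - \<phi> x0 - Dp x0 \<bullet> (x - x0)\<bar> \<le> C * (norm (x - x0))\<^sup>2"
    and em: "\<And>x. x \<in> cBm k x0 d \<Longrightarrow> norm (x - x0) < r \<Longrightarrow>
      \<bar>\<phi> x - \<phi> x0 - Dm x0 \<bullet> (x - x0)\<bar> \<le> C * (norm (x - x0))\<^sup>2"
    by (rule C2_on_half_balls_first_order_estimate[OF assms]) (rule that)
  have "\<phi> x \<le> kinked_quadratic k x0 (\<phi> x0) (Dp x0) C M \<delta> (Dm x0 $ k - Dp x0 $ k - \<delta>) x"
    if "0 < \<delta>" "0 < M" and x: "x \<in> ball x0 (min r (\<delta> / M))" for \<delta> M x
  proof -
    define \<rho> where "\<rho> = norm (x - x0)"
    have \<rho>: "\<rho> < r" "\<rho> < \<delta> / M" using x unfolding \<rho>_def by (auto simp: dist_norm norm_minus_commute)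
    have "\<bar>x $ k\<bar> \<le> \<rho>"
      using component_le_norm_cart[of "x - x0" k] x0k unfolding \<rho>_def by simp
    then have "M * \<bar>x $ k\<bar> \<le> M * \<rho>" using \<open>0 < M\<close> by simp
    moreover have "M * \<rho> < \<delta>" using \<rho>(2) \<open>0 < M\<close> by (simp add: field_simps)
    ultimately have M_xk: "M * \<bar>x $ k\<bar> \<le> \<delta>" by linarith
    have x_in: "x \<in> cball x0 d" using \<rho>(1) \<open>r \<le> d\<close> unfolding \<rho>_def
      by (simp add: dist_norm norm_minus_commute)
    have sq: "(x - x0) \<bullet> (x - x0) = \<rho>\<^sup>2" unfolding \<rho>_def by (simp add: power2_norm_eq_inner)
    show ?thesis
    proof (cases "x $ k \<ge> 0")
      case True
      then have "\<phi> x \<le> \<phi> x0 + Dp x0 \<bullet> (x - x0) + C * \<rho>\<^sup>2"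
        using ep[of x] x_in \<rho>(1) unfolding cBp_def \<rho>_def by auto
      moreover have "M * (x $ k)\<^sup>2 \<le> \<delta> * x $ k"
        using M_xk True by (simp add: power2_eq_square mult_right_mono mult.assoc[symmetric])
      ultimately show ?thesis
        using True unfolding kinked_quadratic_def sq by simp
    next
      case False
      then have "\<phi> x \<le> \<phi> x0 + Dm x0 \<bullet> (x - x0) + C * \<rho>\<^sup>2"
        using em[of x] x_in \<rho>(1) unfolding cBm_def \<rho>_def by auto
      moreover have "Dm x0 \<bullet> (x - x0) = Dp x0 \<bullet> (x - x0) + (Dm x0 $ k - Dp x0 $ k) * x $ k"
        using one_sided_gradients_differ_normally[OF assms, of "x - x0"] x0k by simp
      moreover have "M * (x $ k)\<^sup>2 \<le> - \<delta> * x $ k"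
        using M_xk False mult_right_mono[of "M * \<bar>x $ k\<bar>" \<delta> "- x $ k"]
        by (simp add: power2_eq_square)
      ultimately show ?thesis
        using False unfolding kinked_quadratic_def sq by (simp add: algebra_simps)
    qed
  qed
  then show ?thesis using \<open>0 < r\<close> \<open>r \<le> d\<close> by blast
qed

lemma touch_above_majorant:
  assumes "touch_above u \<phi> x0 d" and "d' \<le> d" and "\<psi> x0 = \<phi> x0"
    and "\<And>x. x \<in> ball x0 d' \<Longrightarrow> \<phi> x \<le> \<psi> x"
  shows "touch_above u \<psi> x0 d'"
  unfolding touch_above_def
proof (intro conjI ballI)
  show "\<psi> x0 = u x0" using assms(1,3) unfolding touch_above_def by simp
  fix x assume x: "x \<in> ball x0 d' \<inter> B1"
  then have "u x \<le> \<phi> x" using assms(1,2) unfolding touch_above_def by auto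
  also have "\<phi> x \<le> \<psi> x" using x assms(4) by blast
  finally show "u x \<le> \<psi> x" .
qed

lemma cond_ii_sub_if_cond_ii'_sub:
  fixes k :: "'n::finite"
  assumes "0 < l" and eFp: "ellipticE l L Fp" and eFm: "ellipticE l L Fm"
    and relaxed: "cond_ii'_sub k Fp Fm fp fm g u"
  shows "cond_ii_sub k g u"
  unfolding cond_ii_sub_def
proof (intro allI impI)
  fix x0 d \<phi> Dp Hp Dm Hm
  assume A: "x0 \<in> Tflat k \<and> 0 < d \<and> continuous_on (ball x0 d) \<phi> \<and>
       C2_on (cBp k x0 d) \<phi> Dp Hp \<and> C2_on (cBm k x0 d) \<phi> Dm Hm \<and> touch_above u \<phi> x0 d"
  then have x0k: "x0 $ k = 0" and "0 < d" unfolding Tflat_def by auto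
  show "g x0 \<le> Dp x0 $ k - Dm x0 $ k"
  proof (rule ccontr)
    define \<delta> where "\<delta> = (g x0 - (Dp x0 $ k - Dm x0 $ k)) / 4"
    assume "\<not> g x0 \<le> Dp x0 $ k - Dm x0 $ k"
    then have "0 < \<delta>" and jump: "Dp x0 $ k - Dm x0 $ k + 2 * \<delta> < g x0"
      unfolding \<delta>_def by (simp_all add: field_simps)
    obtain K r where r: "0 < r" "r \<le> d" and majorant: "\<forall>\<delta>>0. \<forall>M>0. \<forall>x\<in>ball x0 (min r (\<delta> / M)).
        \<phi> x \<le> kinked_quadratic k x0 (\<phi> x0) (Dp x0) K M \<delta> (Dm x0 $ k - Dp x0 $ k - \<delta>) x"
      using kinked_quadratic_majorant[of k x0 d \<phi> Dp Hp Dm Hm] A x0k by blast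
    define H0 where "H0 = barrier_hessian K 0 k"
    define M where "M = (\<bar>Fp H0 - fp x0\<bar> + \<bar>Fm H0 - fm x0\<bar> + 1) / (2 * l)"
    define d' where "d' = min r (\<delta> / M)"
    define \<psi> where "\<psi> = kinked_quadratic k x0 (\<phi> x0) (Dp x0) K M \<delta> (Dm x0 $ k - Dp x0 $ k - \<delta>)"
    have "0 < M" and lM: "2 * l * M = \<bar>Fp H0 - fp x0\<bar> + \<bar>Fm H0 - fm x0\<bar> + 1"
      using \<open>0 < l\<close> unfolding M_def by (simp_all add: add_nonneg_pos)
    then have "0 < d'" using r \<open>0 < \<delta>\<close> unfolding d'_def by simp
    have "\<psi> x0 = \<phi> x0" using x0k unfolding \<psi>_def kinked_quadratic_def by simp
    moreover have "\<phi> x \<le> \<psi> x" if "x \<in> ball x0 d'" for x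
      using majorant \<open>0 < \<delta>\<close> \<open>0 < M\<close> that unfolding \<psi>_def d'_def by blast
    moreover have "d' \<le> d" using r unfolding d'_def by simp
    ultimately have "touch_above u \<psi> x0 d'"
      using A touch_above_majorant[of u \<phi> x0 d d' \<psi>] by blast
    then have "Fp (barrier_hessian K M k) \<ge> fp x0 \<or> Fm (barrier_hessian K M k) \<ge> fm x0
        \<or> \<delta> - (Dm x0 $ k - Dp x0 $ k - \<delta>) \<ge> g x0"
      using relaxed A \<open>0 < d'\<close> x0k
        C2_on_cBp_kinked_quadratic[of k x0 d' "\<phi> x0" "Dp x0" K M \<delta>]
        C2_on_cBm_kinked_quadratic[of k x0 d' "\<phi> x0" "Dp x0" K M _ "Dm x0 $ k - Dp x0 $ k - \<delta>"]
        continuous_on_kinked_quadratic[of "ball x0 d'"]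
      unfolding cond_ii'_sub_def \<psi>_def by (fastforce simp: x0k)
    moreover have "Fp (barrier_hessian K M k) < fp x0" "Fm (barrier_hessian K M k) < fm x0"
      using ellipticE_barrier_hessian[OF eFp] ellipticE_barrier_hessian[OF eFm]
        \<open>0 < M\<close> \<open>0 < l\<close> lM unfolding H0_def
      by (smt (verit))+
    ultimately show False using jump by linarith
  qed
qed

definition dual_operator :: "(real^'n^'n \<Rightarrow> real) \<Rightarrow> real^'n^'n \<Rightarrow> real" where
  "dual_operator F X = - F (- X)"

lemma ellipticE_dual_operator:
  fixes F :: "real^'n^'n \<Rightarrow> real"
  assumes "ellipticE l L F"
  shows "ellipticE l L (dual_operator F)"
  unfolding ellipticE_def
proof (intro conjI allI impI)
  show "dual_operator F 0 = 0" using assms by (simp add: ellipticE_def dual_operator_def)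
  fix M N :: "real^'n^'n"
  assume "sym_mat M \<and> psd_mat N"
  then have "sym_mat (- (M + N))"
    by (simp add: sym_mat_def psd_mat_def vec_eq_iff transpose_def)
  then have "l * onorm ((*v) N) \<le> F (- (M + N) + N) - F (- (M + N))
      \<and> F (- (M + N) + N) - F (- (M + N)) \<le> L * onorm ((*v) N)"
    using assms \<open>sym_mat M \<and> psd_mat N\<close> unfolding ellipticE_def by blast
  moreover have "F (- (M + N) + N) - F (- (M + N)) = dual_operator F (M + N) - dual_operator F M"
    by (simp add: dual_operator_def)
  ultimately show "l * onorm ((*v) N) \<le> dual_operator F (M + N) - dual_operator F M"
    and "dual_operator F (M + N) - dual_operator F M \<le> L * onorm ((*v) N)"
    by linarith+
qed

lemma touch_below_iff_touch_above_uminus: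
  "touch_below u \<phi> x0 d \<longleftrightarrow> touch_above (\<lambda>x. - u x) (\<lambda>x. - \<phi> x) x0 d"
  by (auto simp: touch_below_def touch_above_def)

lemma cond_ii'_sub_dual_if_cond_ii'_super:
  assumes "cond_ii'_super k Fp Fm fp fm g u"
  shows "cond_ii'_sub k (dual_operator Fp) (dual_operator Fm)
    (\<lambda>x. - fp x) (\<lambda>x. - fm x) (\<lambda>x. - g x) (\<lambda>x. - u x)"
  unfolding cond_ii'_sub_def
proof (intro allI impI, elim conjE)
  fix x0 d \<phi> Dp Hp Dm Hm
  assume "x0 \<in> Tflat k" "0 < d" "continuous_on (ball x0 d) \<phi>" "C2_on (cBp k x0 d) \<phi> Dp Hp"
    "C2_on (cBm k x0 d) \<phi> Dm Hm" "touch_above (\<lambda>x. - u x) \<phi> x0 d"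
  then have "Fp (- Hp x0) \<le> fp x0 \<or> Fm (- Hm x0) \<le> fm x0 \<or> (- Dp x0) $ k - (- Dm x0) $ k \<le> g x0"
    using assms[unfolded cond_ii'_super_def, rule_format,
        of x0 d "\<lambda>x. - \<phi> x" "\<lambda>x. - Dp x" "\<lambda>x. - Hp x" "\<lambda>x. - Dm x" "\<lambda>x. - Hm x"]
    by (simp add: continuous_on_minus C2_on_uminus touch_below_iff_touch_above_uminus)
  then show "- fp x0 \<le> dual_operator Fp (Hp x0) \<or> - fm x0 \<le> dual_operator Fm (Hm x0)
      \<or> - g x0 \<le> Dp x0 $ k - Dm x0 $ k"
    by (auto simp: dual_operator_def)
qed

lemma cond_ii_super_if_cond_ii_sub_uminus:
  assumes "cond_ii_sub k (\<lambda>x. - g x) (\<lambda>x. - u x)"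
  shows "cond_ii_super k g u"
  unfolding cond_ii_super_def
proof (intro allI impI, elim conjE)
  fix x0 d \<phi> Dp Hp Dm Hm
  assume "x0 \<in> Tflat k" "0 < d" "continuous_on (ball x0 d) \<phi>" "C2_on (cBp k x0 d) \<phi> Dp Hp"
    "C2_on (cBm k x0 d) \<phi> Dm Hm" "touch_below u \<phi> x0 d"
  then have "- g x0 \<le> (- Dp x0) $ k - (- Dm x0) $ k"
    using assms[unfolded cond_ii_sub_def, rule_format,
        of x0 d "\<lambda>x. - \<phi> x" "\<lambda>x. - Dp x" "\<lambda>x. - Hp x" "\<lambda>x. - Dm x" "\<lambda>x. - Hm x"]
    by (simp add: continuous_on_minus C2_on_uminus touch_below_iff_touch_above_uminus)
  then show "Dp x0 $ k - Dm x0 $ k \<le> g x0" by simp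
qed

theorem mainTheorem10:
  fixes k :: "'n::finite"
    and Fp Fm :: "real^'n^'n \<Rightarrow> real"
    and fp fm g u :: "real^'n \<Rightarrow> real"
    and l L :: real
  assumes "0 < l" and "l \<le> L"
    and "ellipticE l L Fp" and "ellipticE l L Fm"
    and "continuous_on (B1p k \<union> Tflat k) fp"
    and "continuous_on (B1m k \<union> Tflat k) fm"
    and "continuous_on (Tflat k) g"
  shows "(visc_sub_FP k Fp Fm fp fm g u \<longleftrightarrow>
            usc_on u B1 \<and> cond_i_sub k Fp Fm fp fm u \<and> cond_ii'_sub k Fp Fm fp fm g u)
       \<and> (visc_super_FP k Fp Fm fp fm g u \<longleftrightarrow>
            lsc_on u B1 \<and> cond_i_super k Fp Fm fp fm u \<and> cond_ii'_super k Fp Fm fp fm g u)"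
proof -
  have "cond_ii_sub k g u \<Longrightarrow> cond_ii'_sub k Fp Fm fp fm g u"
    unfolding cond_ii_sub_def cond_ii'_sub_def by blast
  then have sub: "cond_ii_sub k g u \<longleftrightarrow> cond_ii'_sub k Fp Fm fp fm g u"
    using cond_ii_sub_if_cond_ii'_sub[OF assms(1,3,4)] by blast
  have "cond_ii_super k g u \<Longrightarrow> cond_ii'_super k Fp Fm fp fm g u"
    unfolding cond_ii_super_def cond_ii'_super_def by blast
  moreover have "cond_ii_super k g u" if "cond_ii'_super k Fp Fm fp fm g u"
  proof -
    have "cond_ii'_sub k (dual_operator Fp) (dual_operator Fm)
        (\<lambda>x. - fp x) (\<lambda>x. - fm x) (\<lambda>x. - g x) (\<lambda>x. - u x)"
      using that by (rule cond_ii'_sub_dual_if_cond_ii'_super)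
    then have "cond_ii_sub k (\<lambda>x. - g x) (\<lambda>x. - u x)"
      using assms(1) ellipticE_dual_operator[OF assms(3)] ellipticE_dual_operator[OF assms(4)]
      by (intro cond_ii_sub_if_cond_ii'_sub)
    then show ?thesis by (rule cond_ii_super_if_cond_ii_sub_uminus)
  qed
  ultimately show ?thesis using sub unfolding visc_sub_FP_def visc_super_FP_def by blast
qed

end
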